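(* There exists a one-relator special inverse monoid $M=\operatorname{Inv}\langle A\mid w=1\rangle$ whose group of units $G$ is not a one-relator group with respect to any finite generating set. Moreover, $M$ can be chosen to be $E$-unitary.
   Context: For an alphabet $A$, $\overline A=A\cup A^{-1}$ with $A^{-1}$ a disjoint copy of formal inverses. $\operatorname{Inv}\langle A\mid w=1\rangle$, with $w\in\overline A^*$, is the inverse monoid defined by the presentation (the quotient of the free inverse monoid on $A$ by the congruence generated by $(w,1)$); such a monoid is called a one-relator special inverse monoid. The group of units of a monoid is the set of its two-sided invertible elements. A one-relator group is a group admitting a presentation with a single defining relation. An inverse monoid $M$ is $E$-unitary if whenever $e$ is idempotent and $es$ is idempotent then $s$ is idempotent; equivalently, only idempotents map to the identity in the maximal group image. *)

theory Defs
  imports "HOL-Algebra.Group"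
begin

inductive_set generated_congruence :: "('a, 'm) monoid_scheme \<Rightarrow> ('a \<times> 'a) set \<Rightarrow> ('a \<times> 'a) set"
  for M (structure) and R where
  base: "(x, y) \<in> R \<Longrightarrow> x \<in> carrier M \<Longrightarrow> y \<in> carrier M \<Longrightarrow> (x, y) \<in> generated_congruence M R"
| refl: "x \<in> carrier M \<Longrightarrow> (x, x) \<in> generated_congruence M R"
| sym: "(x, y) \<in> generated_congruence M R \<Longrightarrow> (y, x) \<in> generated_congruence M R"
| trans: "(x, y) \<in> generated_congruence M R \<Longrightarrow> (y, z) \<in> generated_congruence M R
    \<Longrightarrow> (x, z) \<in> generated_congruence M R"
| mult: "(x, y) \<in> generated_congruence M R \<Longrightarrow> (x', y') \<in> generated_congruence M R
    \<Longrightarrow> (x \<otimes> x', y \<otimes> y') \<in> generated_congruence M R"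

text \<open>For a congruence \<open>E\<close> the union below is over pairwise equal classes, so it is the class of
  \<open>x \<otimes> y\<close> for any representatives.\<close>

definition quotient_monoid :: "('a, 'm) monoid_scheme \<Rightarrow> ('a \<times> 'a) set \<Rightarrow> 'a set monoid" where
  "quotient_monoid M E =
    \<lparr>carrier = carrier M // E,
     mult = (\<lambda>C D. \<Union>x\<in>C. \<Union>y\<in>D. E `` {x \<otimes>\<^bsub>M\<^esub> y}),
     one = E `` {\<one>\<^bsub>M\<^esub>}\<rparr>"

text \<open>The letter \<open>(a, True)\<close> stands for \<open>a\<close> and \<open>(a, False)\<close> for its formal inverse.\<close>

type_synonym 'a word = "('a \<times> bool) list"

definition words :: "'a set \<Rightarrow> 'a word set" where
  "words A = lists (A \<times> UNIV)"

definition word_inv :: "'a word \<Rightarrow> 'a word" where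
  "word_inv u = rev (map (\<lambda>(a, b). (a, \<not> b)) u)"

definition word_monoid :: "'a set \<Rightarrow> 'a word monoid" where
  "word_monoid A = \<lparr>carrier = words A, mult = (@), one = []\<rparr>"

text \<open>The free inverse monoid on \<open>A\<close> is the quotient by the Wagner congruence.\<close>

definition wagner_congruence :: "'a set \<Rightarrow> ('a word \<times> 'a word) set" where
  "wagner_congruence A = generated_congruence (word_monoid A)
     ({(u @ word_inv u @ u, u) | u. u \<in> words A} \<union>
      {(u @ word_inv u @ v @ word_inv v, v @ word_inv v @ u @ word_inv u) | u v.
         u \<in> words A \<and> v \<in> words A})"

definition free_inverse_monoid :: "'a set \<Rightarrow> 'a word set monoid" where
  "free_inverse_monoid A = quotient_monoid (word_monoid A) (wagner_congruence A)"

text \<open>Inverses in an inverse monoid are determined by its multiplication and are preserved by every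
  monoid congruence, so no closure under inversion is needed.\<close>

definition Inv_one_relator :: "'a set \<Rightarrow> 'a word \<Rightarrow> 'a word set set monoid" where
  "Inv_one_relator A w = quotient_monoid (free_inverse_monoid A)
     (generated_congruence (free_inverse_monoid A)
       {(wagner_congruence A `` {w}, \<one>\<^bsub>free_inverse_monoid A\<^esub>)})"

definition E_unitary :: "('a, 'm) monoid_scheme \<Rightarrow> bool" where
  "E_unitary M \<longleftrightarrow> (\<forall>e \<in> carrier M. \<forall>s \<in> carrier M.
     e \<otimes>\<^bsub>M\<^esub> e = e \<longrightarrow>
     (e \<otimes>\<^bsub>M\<^esub> s) \<otimes>\<^bsub>M\<^esub> (e \<otimes>\<^bsub>M\<^esub> s) = e \<otimes>\<^bsub>M\<^esub> s \<longrightarrow>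
     s \<otimes>\<^bsub>M\<^esub> s = s)"

definition free_group_congruence :: "'a set \<Rightarrow> ('a word \<times> 'a word) set" where
  "free_group_congruence S = generated_congruence (word_monoid S)
     {(u @ word_inv u, []) | u. u \<in> words S}"

definition free_group :: "'a set \<Rightarrow> 'a word set monoid" where
  "free_group S = quotient_monoid (word_monoid S) (free_group_congruence S)"

definition Gp_one_relator :: "'a set \<Rightarrow> 'a word \<Rightarrow> 'a word set set monoid" where
  "Gp_one_relator S r = quotient_monoid (free_group S)
     (generated_congruence (free_group S)
       {(free_group_congruence S `` {r}, \<one>\<^bsub>free_group S\<^esub>)})"

text \<open>Every finite alphabet can be renamed to a finite set of natural numbers, so fixing the type
  of generators is no restriction. The relator may be empty or non-reduced, so free groups of
  finite rank are included.\<close>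

definition one_relator_group :: "('g, 'm) monoid_scheme \<Rightarrow> bool" where
  "one_relator_group G \<longleftrightarrow>
     (\<exists>(S :: nat set) r. finite S \<and> r \<in> words S \<and> G \<cong> Gp_one_relator S r)"

end

theory Submission
  imports Defs "HOL-Algebra.Elementary_Groups"
begin

text \<open>The example is \<open>M = Inv\<langle>a, t | a a x\<inverse> x = 1\<rangle>\<close> with \<open>x = t\<inverse> a t\<close>. Every suffix of the
  relator is left invertible in \<open>M\<close>, so \<open>t\<inverse> t = 1\<close> and \<open>x\<inverse> x = 1\<close>, hence \<open>a\<^sup>2 = 1\<close>, \<open>x\<^sup>2 = 1\<close> and
  \<open>t x = a t\<close>. The maximal group image is \<open>K = Gp\<langle>a, t | a\<^sup>2 = 1\<rangle>\<close>, the free product of a group of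
  order two and an infinite cyclic group, and the units of \<open>M\<close> form the infinite dihedral group
  generated by \<open>a\<close> and \<open>x\<close>.

  This group is not a one-relator group. A one-relator group on at most one generator is commutative,
  while one on at least two generators has a nonzero homomorphism to the integers, since a single
  linear equation in two unknowns has a nonzero solution (\<open>one_relator_group_cases\<close>). The two
  involutions \<open>a\<close> and \<open>x\<close> do not commute, and every homomorphism to the integers kills them.

  Both the description of the units and \<open>E\<close>-unitarity are read off from partial actions of \<open>M\<close> by left
  multiplication on sets of reduced words, that is, on subsets of \<open>K\<close>. The letters act by partial
  bijections, so the laws of inverse monoids hold automatically, and such an action factors
  through \<open>M\<close> as soon as the relator acts as the identity (\<open>path_equal\<close>).

  On the whole of \<open>K\<close> the action is total. Reducing a word only uses \<open>a\<^sup>2 = 1\<close>, \<open>t\<inverse> t = 1\<close> and deletion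
  of the idempotent \<open>t t\<inverse>\<close>, so a word equals in \<open>M\<close> its reduced form times an idempotent
  (\<open>path_K_word\<close>). Hence an element that is trivial in \<open>K\<close> is idempotent, which gives
  \<open>E\<close>-unitarity.

  The second action is on the submonoid \<open>P\<close> of \<open>K\<close> generated by \<open>a\<close>, \<open>t\<close> and \<open>x\<close>. Here \<open>t t\<inverse>\<close> is only ever
  deleted in front of a word beginning with \<open>a t\<close>, where \<open>t x = a t\<close> makes the deletion an equality in
  \<open>M\<close>; so whenever \<open>u\<close> can be applied to \<open>1\<close> within \<open>P\<close>, it equals the result in \<open>M\<close>
  (\<open>path_P_word\<close>). This applies to every unit and to its inverse. Elements of \<open>P\<close> have nonnegative exponent
  in \<open>t\<close>, so that of a unit is zero, and then only the generators \<open>a\<close> and \<open>x\<close> occur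
  (\<open>unit_dihedral\<close>).\<close>

section \<open>Quotients of monoids by generated congruences\<close>

lemma generated_congruence_carrier:
  assumes "monoid M" "(x, y) \<in> generated_congruence M R"
  shows "x \<in> carrier M \<and> y \<in> carrier M"
  using assms(2) by induction (auto intro: monoid.m_closed[OF assms(1)])

lemma equiv_generated_congruence:
  assumes "monoid M"
  shows "equiv (carrier M) (generated_congruence M R)"
proof (rule equivI)
  show "generated_congruence M R \<subseteq> carrier M \<times> carrier M"
    using generated_congruence_carrier[OF assms] by auto
  show "refl_on (carrier M) (generated_congruence M R)"
    by (rule refl_onI) (rule generated_congruence.refl)
  show "sym (generated_congruence M R)"
    by (rule symI) (rule generated_congruence.sym)
  show "trans (generated_congruence M R)"
    by (rule transI) (rule generated_congruence.trans)
qed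

lemma generated_congruence_class_eq_iff:
  assumes "monoid M" "x \<in> carrier M" "y \<in> carrier M"
  shows "generated_congruence M R `` {x} = generated_congruence M R `` {y}
    \<longleftrightarrow> (x, y) \<in> generated_congruence M R"
  using eq_equiv_class_iff[OF equiv_generated_congruence[OF assms(1)] assms(2,3)] .

lemma carrier_quotient_monoid:
  "carrier (quotient_monoid M E) = (\<lambda>x. E `` {x}) ` carrier M"
  by (auto simp: quotient_monoid_def quotient_def)

lemma one_quotient_monoid: "\<one>\<^bsub>quotient_monoid M E\<^esub> = E `` {\<one>\<^bsub>M\<^esub>}"
  by (simp add: quotient_monoid_def)

lemma mult_quotient_monoid:
  fixes R :: "('a \<times> 'a) set"
  assumes M: "monoid M" and E: "E = generated_congruence M R"
    and "x \<in> carrier M" "y \<in> carrier M"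
  shows "E `` {x} \<otimes>\<^bsub>quotient_monoid M E\<^esub> E `` {y} = E `` {x \<otimes>\<^bsub>M\<^esub> y}"
proof -
  have same: "E `` {x' \<otimes>\<^bsub>M\<^esub> y'} = E `` {x \<otimes>\<^bsub>M\<^esub> y}"
    if "x' \<in> E `` {x}" "y' \<in> E `` {y}" for x' y'
  proof -
    have "(x \<otimes>\<^bsub>M\<^esub> y, x' \<otimes>\<^bsub>M\<^esub> y') \<in> E"
      using that unfolding E by (intro generated_congruence.mult) auto
    then show ?thesis
      using equiv_class_eq[OF equiv_generated_congruence[OF M]] unfolding E by metis
  qed
  have "E `` {x} \<otimes>\<^bsub>quotient_monoid M E\<^esub> E `` {y}
      = (\<Union>x'\<in>E `` {x}. \<Union>y'\<in>E `` {y}. E `` {x' \<otimes>\<^bsub>M\<^esub> y'})"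
    by (simp add: quotient_monoid_def)
  also have "\<dots> = (\<Union>x'\<in>E `` {x}. \<Union>y'\<in>E `` {y}. E `` {x \<otimes>\<^bsub>M\<^esub> y})"
    by (intro SUP_cong HOL.refl same)
  also have "\<dots> = E `` {x \<otimes>\<^bsub>M\<^esub> y}"
  proof -
    have "E `` {x} \<noteq> {}" "E `` {y} \<noteq> {}"
      using generated_congruence.refl[OF assms(3)] generated_congruence.refl[OF assms(4)]
      unfolding E by blast+
    then show ?thesis by simp
  qed
  finally show ?thesis .
qed

lemma monoid_quotient_monoid:
  assumes M: "monoid M"
  shows "monoid (quotient_monoid M (generated_congruence M R))"
  by (rule monoidI)
    (auto simp: carrier_quotient_monoid one_quotient_monoid mult_quotient_monoid[OF M HOL.refl]
       monoid.m_assoc[OF M] monoid.m_closed[OF M] monoid.one_closed[OF M]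
       monoid.l_one[OF M] monoid.r_one[OF M])

lemma generated_congruence_hom_eq:
  assumes M: "monoid M" and h: "h \<in> hom M N" and "\<And>x y. (x, y) \<in> R \<Longrightarrow> h x = h y"
    and "(x, y) \<in> generated_congruence M R"
  shows "h x = h y"
  using assms(4)
proof induction
  case (mult x y x' y')
  then show ?case
    using generated_congruence_carrier[OF M] h by (metis hom_mult)
qed (use assms(3) in auto)

text \<open>The universal property, which reduces the construction of homomorphisms to checking the generating
  pairs.\<close>

lemma quotient_monoid_lift:
  assumes M: "monoid M" and h: "h \<in> hom M N" and R: "\<And>x y. (x, y) \<in> R \<Longrightarrow> h x = h y"
  obtains h' where "h' \<in> hom (quotient_monoid M (generated_congruence M R)) N"
    and "\<And>x. x \<in> carrier M \<Longrightarrow> h' (generated_congruence M R `` {x}) = h x"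
proof -
  define E where "E = generated_congruence M R"
  have h': "the_elem (h ` (E `` {x})) = h x" if "x \<in> carrier M" for x
  proof -
    have "h ` (E `` {x}) = {h x}"
      using generated_congruence_hom_eq[OF M h R] generated_congruence.refl[OF that]
      unfolding E_def by fastforce
    then show ?thesis by simp
  qed
  have "(\<lambda>C. the_elem (h ` C)) \<in> hom (quotient_monoid M E) N"
  proof (rule homI)
    fix C assume "C \<in> carrier (quotient_monoid M E)"
    then show "the_elem (h ` C) \<in> carrier N"
      using h by (auto simp: carrier_quotient_monoid h' dest: hom_in_carrier)
  next
    fix C D assume "C \<in> carrier (quotient_monoid M E)" "D \<in> carrier (quotient_monoid M E)"
    then obtain x y where xy: "x \<in> carrier M" "y \<in> carrier M" "C = E `` {x}" "D = E `` {y}"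
      by (auto simp: carrier_quotient_monoid)
    then show "the_elem (h ` (C \<otimes>\<^bsub>quotient_monoid M E\<^esub> D))
        = the_elem (h ` C) \<otimes>\<^bsub>N\<^esub> the_elem (h ` D)"
      using h M by (simp add: mult_quotient_monoid[OF M E_def] h' monoid.m_closed hom_mult)
  qed
  then show thesis using that h' unfolding E_def by blast
qed

section \<open>Words\<close>

lemma words_Nil [simp]: "[] \<in> words A"
  and words_Cons [simp]: "c # u \<in> words A \<longleftrightarrow> fst c \<in> A \<and> u \<in> words A"
  and words_append [simp]: "u @ v \<in> words A \<longleftrightarrow> u \<in> words A \<and> v \<in> words A"
  by (cases c; auto simp: words_def)+

lemma word_inv_simps [simp]:
  "word_inv [] = []"
  "word_inv (c # u) = word_inv u @ [(fst c, \<not> snd c)]"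
  "word_inv (u @ v) = word_inv v @ word_inv u"
  by (cases c; simp add: word_inv_def)+

lemma word_inv_in_words [simp]: "word_inv u \<in> words A \<longleftrightarrow> u \<in> words A"
  by (induction u) auto

lemma word_inv_word_inv [simp]: "word_inv (word_inv u) = u"
  by (induction u) auto

lemma word_monoid_simps [simp]:
  "carrier (word_monoid A) = words A"
  "mult (word_monoid A) = (@)"
  "one (word_monoid A) = []"
  by (auto simp: word_monoid_def)

lemma monoid_word_monoid: "monoid (word_monoid A)"
  by (rule monoidI) auto

section \<open>Presentations with one additional relation\<close>

text \<open>Free groups and free inverse monoids are both quotients of the monoid of words, so adding one
  relation \<open>w = 1\<close> to either of them is an instance of the following construction.\<close>

definition presented :: "'a set \<Rightarrow> ('a word \<times> 'a word) set \<Rightarrow> 'a word \<Rightarrow> 'a word set set monoid" where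
  "presented A R w =
     (let E = generated_congruence (word_monoid A) R; F = quotient_monoid (word_monoid A) E
      in quotient_monoid F (generated_congruence F {(E `` {w}, \<one>\<^bsub>F\<^esub>)}))"

definition presented_class :: "'a set \<Rightarrow> ('a word \<times> 'a word) set \<Rightarrow> 'a word \<Rightarrow> 'a word \<Rightarrow> 'a word set set" where
  "presented_class A R w u =
     (let E = generated_congruence (word_monoid A) R; F = quotient_monoid (word_monoid A) E
      in generated_congruence F {(E `` {w}, \<one>\<^bsub>F\<^esub>)} `` {E `` {u}})"

lemma monoid_presented: "monoid (presented A R w)"
  unfolding presented_def Let_def
  by (intro monoid_quotient_monoid monoid_word_monoid)

lemma carrier_presented: "carrier (presented A R w) = presented_class A R w ` words A"
  by (auto simp: presented_def presented_class_def Let_def carrier_quotient_monoid)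

lemma one_presented: "\<one>\<^bsub>presented A R w\<^esub> = presented_class A R w []"
  by (simp add: presented_def presented_class_def Let_def one_quotient_monoid)

lemma mult_presented:
  assumes "u \<in> words A" "v \<in> words A"
  shows "presented_class A R w u \<otimes>\<^bsub>presented A R w\<^esub> presented_class A R w v
    = presented_class A R w (u @ v)"
  using assms unfolding presented_def presented_class_def Let_def
  by (simp add: mult_quotient_monoid[OF monoid_quotient_monoid[OF monoid_word_monoid] HOL.refl]
      mult_quotient_monoid[OF monoid_word_monoid HOL.refl] carrier_quotient_monoid)

lemma presented_class_rel:
  assumes "(u, v) \<in> R" "u \<in> words A" "v \<in> words A"
  shows "presented_class A R w u = presented_class A R w v"
proof -
  have "generated_congruence (word_monoid A) R `` {u} = generated_congruence (word_monoid A) R `` {v}"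
    using assms by (subst generated_congruence_class_eq_iff[OF monoid_word_monoid])
      (auto intro: generated_congruence.base)
  then show ?thesis by (simp add: presented_class_def)
qed

lemma presented_class_relator:
  assumes "w \<in> words A"
  shows "presented_class A R w w = presented_class A R w []"
  unfolding presented_class_def Let_def using assms
  by (subst generated_congruence_class_eq_iff[OF monoid_quotient_monoid[OF monoid_word_monoid]])
    (auto simp: carrier_quotient_monoid one_quotient_monoid intro!: generated_congruence.base)

text \<open>The universal property is applied to the two quotients in turn.\<close>

lemma presented_lift:
  assumes f: "f \<in> hom (word_monoid A) N" and w: "w \<in> words A"
    and R: "\<And>u v. (u, v) \<in> R \<Longrightarrow> f u = f v" and fw: "f w = f []"
  obtains h where "h \<in> hom (presented A R w) N"
    and "\<And>u. u \<in> words A \<Longrightarrow> h (presented_class A R w u) = f u"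
proof -
  define E where "E = generated_congruence (word_monoid A) R"
  define F where "F = quotient_monoid (word_monoid A) E"
  obtain g where g: "g \<in> hom F N" "\<And>u. u \<in> words A \<Longrightarrow> g (E `` {u}) = f u"
    unfolding F_def E_def using quotient_monoid_lift[OF monoid_word_monoid f R] by auto
  have one: "\<one>\<^bsub>F\<^esub> = E `` {[]}"
    by (simp add: F_def one_quotient_monoid)
  have M: "monoid F"
    unfolding F_def E_def by (intro monoid_quotient_monoid monoid_word_monoid)
  obtain h where "h \<in> hom (quotient_monoid F (generated_congruence F {(E `` {w}, \<one>\<^bsub>F\<^esub>)})) N"
    "\<And>x. x \<in> carrier F \<Longrightarrow> h (generated_congruence F {(E `` {w}, \<one>\<^bsub>F\<^esub>)} `` {x}) = g x"
    using quotient_monoid_lift[OF M g(1), of "{(E `` {w}, \<one>\<^bsub>F\<^esub>)}"] g(2) w fw one by auto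
  then show thesis
    using that g(2) by (auto simp: presented_def presented_class_def Let_def E_def F_def
        carrier_quotient_monoid)
qed

section \<open>One-relator groups\<close>

definition free_group_relations :: "'a set \<Rightarrow> ('a word \<times> 'a word) set" where
  "free_group_relations S = {(u @ word_inv u, []) | u. u \<in> words S}"

lemma Gp_one_relator_eq: "Gp_one_relator S r = presented S (free_group_relations S) r"
  by (simp add: free_group_relations_def Gp_one_relator_def free_group_def
      free_group_congruence_def presented_def Let_def)

definition weight :: "('a \<Rightarrow> int) \<Rightarrow> 'a word \<Rightarrow> int" where
  "weight k u = (\<Sum>c\<leftarrow>u. if snd c then k (fst c) else - k (fst c))"

lemma weight_simps [simp]:
  "weight k [] = 0"
  "weight k (c # u) = (if snd c then k (fst c) else - k (fst c)) + weight k u"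
  "weight k (u @ v) = weight k u + weight k v"
  by (auto simp: weight_def)

lemma weight_word_inv [simp]: "weight k (word_inv u) = - weight k u"
  by (induction u) auto

lemma weight_linear:
  "weight (\<lambda>s. m * k s + n * l s) u = m * weight k u + n * weight l u"
  by (induction u) (auto simp: algebra_simps)

text \<open>All letters are powers of the one generator, so they commute with each other, and then so do words.\<close>

lemma Gp_one_relator_commutative:
  assumes S: "S \<subseteq> {s}" and x: "x \<in> carrier (Gp_one_relator S r)" and y: "y \<in> carrier (Gp_one_relator S r)"
  shows "x \<otimes>\<^bsub>Gp_one_relator S r\<^esub> y = y \<otimes>\<^bsub>Gp_one_relator S r\<^esub> x"
proof -
  let ?c = "presented_class S (free_group_relations S) r"
  have cong: "?c (u @ v) = ?c (u' @ v')"
    if "?c u = ?c u'" "?c v = ?c v'" "u \<in> words S" "v \<in> words S" "u' \<in> words S" "v' \<in> words S"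
    for u v u' v'
    using that mult_presented by metis
  have letters: "?c [p, q] = ?c [q, p]" if "fst p \<in> S" "fst q \<in> S" for p q
  proof (cases "snd p = snd q")
    case True
    then have "p = q" using that S by (auto simp: prod_eq_iff)
    then show ?thesis by simp
  next
    case False
    then have "q = (fst p, \<not> snd p)" "p = (fst q, \<not> snd q)" using that S by (auto simp: prod_eq_iff)
    then have "[p, q] = [p] @ word_inv [p]" "[q, p] = [q] @ word_inv [q]"
      by (simp_all add: prod_eq_iff)
    then have "([p, q], []) \<in> free_group_relations S" "([q, p], []) \<in> free_group_relations S"
      using that unfolding free_group_relations_def by (metis (mono_tags, lifting) mem_Collect_eq words_Cons words_Nil)+
    then show ?thesis using that presented_class_rel[of _ "[]" "free_group_relations S" S r] by simp
  qed
  have letter: "?c (p # v) = ?c (v @ [p])" if "fst p \<in> S" "v \<in> words S" for p v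
    using that(2)
  proof (induction v)
    case (Cons q v)
    then have IH: "?c (p # v) = ?c (v @ [p])" by simp
    have "?c ([p, q] @ v) = ?c ([q, p] @ v)"
      by (rule cong[OF letters HOL.refl]) (use Cons that(1) in auto)
    moreover have "?c ([q] @ p # v) = ?c ([q] @ v @ [p])"
      by (rule cong[OF HOL.refl IH]) (use Cons that(1) in auto)
    ultimately show ?case by simp
  qed simp
  have "?c (u @ v) = ?c (v @ u)" if "u \<in> words S" "v \<in> words S" for u v
    using that(1)
  proof (induction u)
    case (Cons p u)
    then have IH: "?c (u @ v) = ?c (v @ u)" by simp
    have "?c ([p] @ (u @ v)) = ?c ([p] @ (v @ u))"
      by (rule cong[OF HOL.refl IH]) (use Cons that(2) in auto)
    moreover have "?c ((p # v) @ u) = ?c ((v @ [p]) @ u)"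
      by (rule cong[OF letter HOL.refl]) (use Cons that(2) in auto)
    ultimately show ?case by simp
  qed simp
  then show ?thesis
    using x y by (auto simp: Gp_one_relator_eq carrier_presented mult_presented)
qed

text \<open>The abelianisation has at least two generators and only one relation, so it is infinite.\<close>

lemma Gp_one_relator_hom_integer:
  assumes "s \<in> S" "s' \<in> S" "s \<noteq> s'" and r: "r \<in> words S"
  obtains h g where "h \<in> hom (Gp_one_relator S r) integer_group"
    and "g \<in> carrier (Gp_one_relator S r)" and "h g \<noteq> 0"
proof -
  \<comment> \<open>Weights \<open>m\<close> on \<open>s\<close> and \<open>n\<close> on \<open>s'\<close> vanish on the relator exactly when \<open>m * e s + n * e s' = 0\<close>,
    where \<open>e z\<close> is the exponent sum of \<open>z\<close> in the relator.\<close>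
  define d :: "'a \<Rightarrow> 'a \<Rightarrow> int" where "d z y = (if y = z then 1 else 0)" for z y
  define e where "e z = weight (d z) r" for z
  obtain m n where mn: "m * e s + n * e s' = 0" "m \<noteq> 0 \<or> n \<noteq> 0"
  proof (cases "e s = 0 \<and> e s' = 0")
    case True
    then show ?thesis using that[of 1 1] by simp
  next
    case False
    then show ?thesis using that[of "e s'" "- e s"] by auto
  qed
  define k where "k y = m * d s y + n * d s' y" for y
  have kr: "weight k r = 0"
    using mn(1) by (simp add: k_def[abs_def] e_def weight_linear)
  have hom: "weight k \<in> hom (word_monoid S) integer_group"
    by (rule homI) auto
  have rel: "weight k u = weight k v" if "(u, v) \<in> free_group_relations S" for u v
    using that by (auto simp: free_group_relations_def)
  obtain h where h: "h \<in> hom (Gp_one_relator S r) integer_group"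
    "\<And>u. u \<in> words S \<Longrightarrow> h (presented_class S (free_group_relations S) r u) = weight k u"
    unfolding Gp_one_relator_eq
    by (rule presented_lift[OF hom r, of "free_group_relations S"]) (use kr rel in auto)
  have "k s \<noteq> 0 \<or> k s' \<noteq> 0" using mn(2) assms(3) by (auto simp: k_def d_def)
  then obtain z where z: "z \<in> S" "k z \<noteq> 0" using assms(1,2) by blast
  show thesis
    by (rule that[OF h(1), of "presented_class S (free_group_relations S) r [(z, True)]"])
      (use z h(2) in \<open>auto simp: Gp_one_relator_eq carrier_presented\<close>)
qed

text \<open>The alternatives correspond to presentations on at most one and on at least two generators.\<close>

lemma one_relator_group_cases:
  assumes G: "monoid G" and "one_relator_group G"
  obtains (commutative) "\<And>x y. x \<in> carrier G \<Longrightarrow> y \<in> carrier G \<Longrightarrow> x \<otimes>\<^bsub>G\<^esub> y = y \<otimes>\<^bsub>G\<^esub> x"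
    | (hom_integer) h g where "h \<in> hom G integer_group" "g \<in> carrier G" "h g \<noteq> 0"
proof -
  obtain S :: "nat set" and r f where r: "r \<in> words S" and f: "f \<in> iso G (Gp_one_relator S r)"
    using assms(2) by (auto simp: one_relator_group_def is_iso_def)
  have hom: "f \<in> hom G (Gp_one_relator S r)"
    and bij: "bij_betw f (carrier G) (carrier (Gp_one_relator S r))"
    using f by (auto simp: iso_def)
  show thesis
  proof (cases "\<exists>s\<in>S. \<exists>s'\<in>S. s \<noteq> s'")
    case True
    then obtain h g where h: "h \<in> hom (Gp_one_relator S r) integer_group"
      "g \<in> carrier (Gp_one_relator S r)" "h g \<noteq> 0"
      using Gp_one_relator_hom_integer[OF _ _ _ r] by metis
    then obtain x where "x \<in> carrier G" "f x = g"
      using bij by (metis bij_betw_imp_surj_on imageE)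
    moreover have "h \<circ> f \<in> hom G integer_group"
      using hom h(1) by (rule hom_compose)
    ultimately show thesis using hom_integer[of "h \<circ> f" x] h by auto
  next
    case False
    have "S \<subseteq> {SOME s. s \<in> S}"
    proof
      fix s assume s: "s \<in> S"
      then have "(SOME s. s \<in> S) \<in> S" by (rule someI)
      with s False show "s \<in> {SOME s. s \<in> S}" by auto
    qed
    note comm = Gp_one_relator_commutative[OF this]
    show thesis
    proof (rule commutative)
      fix x y assume xy: "x \<in> carrier G" "y \<in> carrier G"
      have "f (x \<otimes>\<^bsub>G\<^esub> y) = f (y \<otimes>\<^bsub>G\<^esub> x)"
        using comm[OF hom_in_carrier[OF hom xy(1)] hom_in_carrier[OF hom xy(2)]]
        by (simp add: hom_mult[OF hom] xy)
      then show "x \<otimes>\<^bsub>G\<^esub> y = y \<otimes>\<^bsub>G\<^esub> x"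
        by (rule inj_onD[OF bij_betw_imp_inj_on[OF bij]]) (simp_all add: monoid.m_closed[OF G] xy)
    qed
  qed
qed

section \<open>One-relator special inverse monoids\<close>

definition wagner_relations :: "'a set \<Rightarrow> ('a word \<times> 'a word) set" where
  "wagner_relations A =
     {(u @ word_inv u @ u, u) | u. u \<in> words A} \<union>
     {(u @ word_inv u @ v @ word_inv v, v @ word_inv v @ u @ word_inv u) | u v.
        u \<in> words A \<and> v \<in> words A}"

lemma Inv_one_relator_eq: "Inv_one_relator A w = presented A (wagner_relations A) w"
  by (simp add: Inv_one_relator_def free_inverse_monoid_def wagner_congruence_def
      wagner_relations_def presented_def Let_def)

locale special_inverse_monoid =
  fixes A :: "'a set" and w :: "'a word"
  assumes relator: "w \<in> words A"
begin

abbreviation "M \<equiv> Inv_one_relator A w"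

definition cl :: "'a word \<Rightarrow> 'a word set set" where
  "cl = presented_class A (wagner_relations A) w"

text \<open>Membership of both words is included, so that it need not be carried along separately in chains
  of equalities.\<close>

definition equal :: "'a word \<Rightarrow> 'a word \<Rightarrow> bool" (infix "\<approx>" 50) where
  "u \<approx> v \<longleftrightarrow> u \<in> words A \<and> v \<in> words A \<and> cl u = cl v"

lemma monoid_M: "monoid M"
  and carrier_M: "carrier M = cl ` words A"
  and one_M: "\<one>\<^bsub>M\<^esub> = cl []"
  by (simp_all add: Inv_one_relator_eq cl_def monoid_presented carrier_presented one_presented)

lemma mult_M: "u \<in> words A \<Longrightarrow> v \<in> words A \<Longrightarrow> cl u \<otimes>\<^bsub>M\<^esub> cl v = cl (u @ v)"
  by (simp add: Inv_one_relator_eq cl_def mult_presented)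

lemma equal_refl: "u \<in> words A \<Longrightarrow> u \<approx> u"
  and equal_sym: "u \<approx> v \<Longrightarrow> v \<approx> u"
  and equal_trans [trans]: "u \<approx> v \<Longrightarrow> v \<approx> v' \<Longrightarrow> u \<approx> v'"
  by (auto simp: equal_def)

lemma equal_append: "u \<approx> u' \<Longrightarrow> v \<approx> v' \<Longrightarrow> u @ v \<approx> u' @ v'"
  unfolding equal_def using mult_M by (metis words_append)

lemma equal_context: "u \<approx> v \<Longrightarrow> p \<in> words A \<Longrightarrow> q \<in> words A \<Longrightarrow> p @ u @ q \<approx> p @ v @ q"
  by (intro equal_append equal_refl)

lemma equal_inverse: "u \<in> words A \<Longrightarrow> u @ word_inv u @ u \<approx> u"
  unfolding equal_def cl_def
  by (intro conjI presented_class_rel) (auto simp: wagner_relations_def)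

lemma equal_idempotents_commute:
  "u \<in> words A \<Longrightarrow> v \<in> words A \<Longrightarrow>
    u @ word_inv u @ v @ word_inv v \<approx> v @ word_inv v @ u @ word_inv u"
  unfolding equal_def cl_def
  by (intro conjI presented_class_rel) (auto simp: wagner_relations_def)

lemma equal_relator: "w \<approx> []"
  unfolding equal_def cl_def using relator by (simp add: presented_class_relator)

text \<open>Multiply \<open>p s s\<inverse> s = p s\<close> out: the factor \<open>p s = 1\<close> disappears on both sides.\<close>

lemma suffix_left_invertible:
  assumes "p @ s \<approx> []"
  shows "word_inv s @ s \<approx> []"
proof -
  have ps: "p \<in> words A" "s \<in> words A" using assms by (auto simp: equal_def)
  have "[] @ word_inv s @ s \<approx> (p @ s) @ word_inv s @ s"
    using equal_sym[OF assms] ps by (intro equal_append equal_refl) auto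
  also have "\<dots> \<approx> p @ s"
    using equal_append[OF equal_refl[OF ps(1)] equal_inverse[OF ps(2)]] by simp
  also have "\<dots> \<approx> []" by fact
  finally show ?thesis by simp
qed

text \<open>Every idempotent of an inverse monoid has the form \<open>z z\<inverse>\<close>. Working with formal products of such
  elements makes it immediate that deletions of idempotents can be accumulated.\<close>

definition idem :: "'a word list \<Rightarrow> 'a word" where
  "idem zs = concat (map (\<lambda>z. z @ word_inv z) zs)"

lemma idem_simps [simp]:
  "idem [] = []" "idem (z # zs) = z @ word_inv z @ idem zs" "idem (ys @ zs) = idem ys @ idem zs"
  by (auto simp: idem_def)

lemma idem_in_words [simp]: "idem zs \<in> words A \<longleftrightarrow> set zs \<subseteq> words A"
  by (induction zs) auto

lemma idem_commute:
  assumes "z \<in> words A" "set zs \<subseteq> words A"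
  shows "idem zs @ z @ word_inv z \<approx> z @ word_inv z @ idem zs"
  using assms(2)
proof (induction zs)
  case Nil
  then show ?case using assms(1) by (auto intro: equal_refl)
next
  case (Cons y zs)
  have "(y @ word_inv y) @ (idem zs @ z @ word_inv z) \<approx> (y @ word_inv y) @ (z @ word_inv z @ idem zs)"
    using Cons by (intro equal_append equal_refl Cons.IH) auto
  also have "\<dots> = (y @ word_inv y @ z @ word_inv z) @ idem zs" by simp
  also have "\<dots> \<approx> (z @ word_inv z @ y @ word_inv y) @ idem zs"
    using Cons assms(1) by (intro equal_append equal_refl equal_idempotents_commute) auto
  finally show ?case by simp
qed

lemma idem_idempotent:
  assumes "set zs \<subseteq> words A"
  shows "idem zs @ idem zs \<approx> idem zs"
  using assms
proof (induction zs)
  case Nil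
  then show ?case by (auto intro: equal_refl)
next
  case (Cons z zs)
  have "z @ word_inv z @ (idem zs @ z @ word_inv z) @ idem zs
      \<approx> z @ word_inv z @ (z @ word_inv z @ idem zs) @ idem zs"
    using Cons by (intro equal_append equal_refl idem_commute) auto
  also have "\<dots> = (z @ word_inv z @ z) @ word_inv z @ (idem zs @ idem zs)" by simp
  also have "\<dots> \<approx> z @ word_inv z @ idem zs"
    using Cons by (intro equal_append equal_refl equal_inverse Cons.IH) auto
  finally show ?case by simp
qed

text \<open>Deleting a factor \<open>c c\<inverse>\<close> in front of \<open>p\<close> costs an idempotent, which can be moved behind \<open>p\<close>: it is
  \<open>p\<inverse> c\<close> times its inverse.\<close>

lemma cancel_below:
  assumes "[c] \<in> words A" "p \<in> words A"
  shows "[c, (fst c, \<not> snd c)] @ p \<approx> p @ idem [word_inv p @ [c]]"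
proof -
  have c: "[c, (fst c, \<not> snd c)] = [c] @ word_inv [c]" by simp
  have "([c] @ word_inv [c]) @ p \<approx> ([c] @ word_inv [c]) @ (p @ word_inv p @ p)"
    using assms by (intro equal_append equal_refl equal_sym[OF equal_inverse]) auto
  also have "\<dots> = ([c] @ word_inv [c] @ p @ word_inv p) @ p" by simp
  also have "\<dots> \<approx> (p @ word_inv p @ [c] @ word_inv [c]) @ p"
    using assms by (intro equal_append equal_refl equal_idempotents_commute) auto
  finally show ?thesis by simp
qed

end

section \<open>Actions by partial bijections\<close>

text \<open>A pair \<open>(q, p)\<close> in \<open>\<rho> c\<close> means \<open>q = c \<cdot> p\<close>. With the result on the left, composition of relations
  follows the order of letters in a word.\<close>

locale partial_action =
  fixes N :: "'s set" and \<rho> :: "'a \<times> bool \<Rightarrow> 's rel"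
  assumes rho_subset: "\<rho> c \<subseteq> N \<times> N"
    and rho_inverse: "\<rho> (x, \<not> b) = (\<rho> (x, b))\<inverse>"
    and single_valued_rho: "single_valued (\<rho> c)"
begin

primrec path :: "'a word \<Rightarrow> 's rel" where
  "path [] = Id_on N"
| "path (c # u) = \<rho> c O path u"

lemma path_subset: "path u \<subseteq> N \<times> N"
  by (induction u) (use rho_subset in \<open>auto simp: Id_on_def\<close>)

lemma path_append: "path (u @ v) = path u O path v"
proof (induction u)
  case Nil
  then show ?case using path_subset[of v] by (auto simp: Id_on_def)
qed auto

lemma path_word_inv: "path (word_inv u) = (path u)\<inverse>"
proof (induction u)
  case (Cons c u)
  have "path [(fst c, \<not> snd c)] = (\<rho> c)\<inverse>"
    using rho_inverse[of "fst c" "snd c"] rho_subset[of c] by (auto simp: Id_on_def)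
  then show ?case using Cons by (simp add: path_append converse_relcomp)
qed auto

lemma single_valued_path: "single_valued (path u)"
  by (induction u) (auto intro: single_valued_relcomp single_valued_rho)

lemma injective_path: "(p, q) \<in> path u \<Longrightarrow> (p', q) \<in> path u \<Longrightarrow> p = p'"
  using single_valued_path[of "word_inv u"] by (auto simp: path_word_inv single_valued_def)

lemma path_idempotent_left: "path u O (path u)\<inverse> = Id_on (Domain (path u))"
  using injective_path[of _ _ u] by (auto simp: Id_on_def)

lemma path_idempotent_right: "(path u)\<inverse> O path u = Id_on (Range (path u))"
  using single_valued_path[of u] by (auto simp: Id_on_def single_valued_def)

definition rel_monoid :: "'s rel monoid" where
  "rel_monoid = \<lparr>carrier = Pow (N \<times> N), mult = (O), one = Id_on N\<rparr>"

text \<open>Partial bijections satisfy the Wagner relations: \<open>f f\<inverse>\<close> is a partial identity, and partial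
  identities commute. Only the relator has to be checked.\<close>

theorem path_equal:
  assumes "special_inverse_monoid A w" and w: "path w = Id_on N"
    and "special_inverse_monoid.equal A w u v"
  shows "path u = path v"
proof -
  interpret special_inverse_monoid A w by fact
  have hom: "path \<in> hom (word_monoid A) rel_monoid"
    by (rule homI) (use path_subset in \<open>auto simp: rel_monoid_def path_append\<close>)
  have rel: "path x = path y" if xy: "(x, y) \<in> wagner_relations A" for x y
  proof -
    consider z where "x = z @ word_inv z @ z" "y = z"
      | z z' where "x = z @ word_inv z @ z' @ word_inv z'" "y = z' @ word_inv z' @ z @ word_inv z"
      using xy unfolding wagner_relations_def by blast
    then show ?thesis
    proof cases
      case 1
      have "path x = (path z O (path z)\<inverse>) O path z"
        by (simp add: 1 path_append path_word_inv O_assoc)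
      then show ?thesis by (auto simp: 1 path_idempotent_left Id_on_def)
    next
      case 2
      have "path x = (path z O (path z)\<inverse>) O (path z' O (path z')\<inverse>)"
        "path y = (path z' O (path z')\<inverse>) O (path z O (path z)\<inverse>)"
        by (simp_all add: 2 path_append path_word_inv O_assoc)
      then show ?thesis by (auto simp: path_idempotent_left Id_on_def)
    qed
  qed
  obtain h where "\<And>x. x \<in> words A \<Longrightarrow> h (cl x) = path x"
    unfolding cl_def
    by (rule presented_lift[OF hom relator, of "wagner_relations A"]) (use w rel in auto)
  moreover have "u \<in> words A" "v \<in> words A" "h (cl u) = h (cl v)"
    using assms(3) by (simp_all add: equal_def)
  ultimately show ?thesis by simp
qed

end

section \<open>The relator and its consequences\<close>

(* The generator 1 is to stay in the form in which it occurs in the words. *)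
declare One_nat_def [simp del]

abbreviation (input) a :: "nat \<times> bool" where "a \<equiv> (0, True)"
abbreviation (input) a' :: "nat \<times> bool" where "a' \<equiv> (0, False)"
abbreviation (input) t :: "nat \<times> bool" where "t \<equiv> (1, True)"
abbreviation (input) t' :: "nat \<times> bool" where "t' \<equiv> (1, False)"

definition example_relator :: "nat word" where
  "example_relator = [a, a, t', a', t, t', a, t]"

interpretation ex: special_inverse_monoid "{0, 1}" example_relator
  by unfold_locales (simp add: example_relator_def)

notation ex.equal (infix "\<approx>" 50)

text \<open>The consequences of the relator that a calculation in \<open>M\<close> needs. The first two hold since \<open>x\<close> and
  \<open>t\<close> are suffixes of the relator.\<close>

lemma x_left_invertible: "[t', a', t, t', a, t] \<approx> []"
  using ex.suffix_left_invertible[of "[a, a, t', a', t]" "[t', a, t]"] ex.equal_relator by (simp add: example_relator_def)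

lemma t_left_invertible: "[t', t] \<approx> []"
  using ex.suffix_left_invertible[of "[a, a, t', a', t, t', a]" "[t]"] ex.equal_relator by (simp add: example_relator_def)

text \<open>Since \<open>x\<inverse> x = 1\<close>, what remains of the relator is \<open>a a\<close>.\<close>

lemma a_square: "[a, a] \<approx> []"
proof -
  have "[a, a] @ [] \<approx> [a, a] @ [t', a', t, t', a, t]"
    by (intro ex.equal_append ex.equal_refl ex.equal_sym[OF x_left_invertible]) simp
  also have "\<dots> \<approx> []" using ex.equal_relator by (simp add: example_relator_def)
  finally show ?thesis by simp
qed

lemma a_inverse: "[a'] \<approx> [a]"
proof -
  have "[a'] @ [] \<approx> [a'] @ [a, a]"
    by (intro ex.equal_append ex.equal_refl ex.equal_sym[OF a_square]) simp
  also have "\<dots> = [a', a] @ [a]" by simp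
  also have "\<dots> \<approx> [] @ [a]"
    using ex.suffix_left_invertible[of "[a]" "[a]"] a_square
    by (intro ex.equal_append ex.equal_refl) auto
  finally show ?thesis by simp
qed

lemma x_square: "[t', a, t, t', a, t] \<approx> []"
proof -
  have "[t'] @ [a] @ [t, t', a, t] \<approx> [t'] @ [a'] @ [t, t', a, t]"
    by (intro ex.equal_context ex.equal_sym[OF a_inverse]) auto
  also have "\<dots> \<approx> []" using x_left_invertible by simp
  finally show ?thesis by simp
qed

text \<open>The idempotent \<open>t t\<inverse>\<close> fixes \<open>a t\<close>: it commutes with \<open>(a t) (a t)\<inverse>\<close>, and \<open>(a t)\<inverse> t t\<inverse> (a t) = x\<inverse> x = 1\<close>.\<close>

lemma t_x: "[t, t', a, t] \<approx> [a, t]"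
proof -
  have "[t, t'] @ [a, t] \<approx> [t, t'] @ ([a, t] @ word_inv [a, t] @ [a, t])"
    by (intro ex.equal_append ex.equal_refl ex.equal_sym[OF ex.equal_inverse]) auto
  also have "\<dots> = ([t] @ word_inv [t] @ [a, t] @ word_inv [a, t]) @ [a, t]" by simp
  also have "\<dots> \<approx> ([a, t] @ word_inv [a, t] @ [t] @ word_inv [t]) @ [a, t]"
    by (intro ex.equal_append ex.equal_refl ex.equal_idempotents_commute) auto
  also have "\<dots> = [a, t] @ [t', a', t, t', a, t]" by simp
  also have "\<dots> \<approx> [a, t] @ []"
    by (intro ex.equal_append ex.equal_refl x_left_invertible) auto
  finally show ?thesis by simp
qed

section \<open>Two actions on reduced words\<close>

text \<open>In \<open>K\<close> the letters \<open>a\<close> and \<open>a\<inverse>\<close> agree, so only \<open>a\<close> is used in reduced words; \<open>opposite c\<close> is then the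
  letter that \<open>c\<close> cancels.\<close>

definition canonical :: "nat \<times> bool \<Rightarrow> nat \<times> bool" where
  "canonical c = (if fst c = 0 then a else c)"

definition opposite :: "nat \<times> bool \<Rightarrow> nat \<times> bool" where
  "opposite c = canonical (fst c, \<not> snd c)"

text \<open>Normal forms of the elements of \<open>K\<close>.\<close>

definition reduced :: "nat word set" where
  "reduced = {p. set p \<subseteq> {a, t, t'} \<and> successively (\<lambda>c d. d \<noteq> opposite c) p}"

text \<open>The words in \<open>a\<close>, \<open>t\<close> and \<open>x = t\<inverse> a t\<close>, written out in letters.\<close>

inductive_set positive :: "nat word set" where
  Nil: "[] \<in> positive"
| a: "p \<in> positive \<Longrightarrow> a # p \<in> positive"
| t: "p \<in> positive \<Longrightarrow> t # p \<in> positive"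
| x: "p \<in> positive \<Longrightarrow> t' # a # t # p \<in> positive"

text \<open>Left multiplication in \<open>K\<close>, restricted to those \<open>p\<close> for which \<open>p\<close> and the product both lie in \<open>N\<close>.\<close>

definition left_mult :: "nat word set \<Rightarrow> nat \<times> bool \<Rightarrow> nat word rel" where
  "left_mult N c = {(q, p). q \<in> N \<and> p \<in> N \<and> (q = canonical c # p \<or> p = opposite c # q)}"

lemma reduced_simps:
  "[] \<in> reduced"
  "c # p \<in> reduced \<longleftrightarrow> c \<in> {a, t, t'} \<and> p \<in> reduced \<and> (p = [] \<or> hd p \<noteq> opposite c)"
  by (auto simp: reduced_def successively_Cons)

lemma partial_action_left_mult:
  assumes "N \<subseteq> reduced"
  shows "partial_action N (left_mult N)"
proof
  show "left_mult N c \<subseteq> N \<times> N" for c by (auto simp: left_mult_def)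
  show "left_mult N (x, \<not> b) = (left_mult N (x, b))\<inverse>" for x b
    by (auto simp: left_mult_def opposite_def canonical_def)
  have "opposite c # canonical c # p \<notin> reduced" for c p
    by (auto simp: reduced_simps opposite_def canonical_def)
  then have no: "opposite c # canonical c # p \<notin> N" for c p
    using assms by blast
  show "single_valued (left_mult N c)" for c
    using no[of c] by (auto simp: left_mult_def single_valued_def)
qed

text \<open>The relator is \<open>a a\<inverse>\<close>, up to the identification of \<open>a\<close> and \<open>a\<inverse>\<close>, followed by \<open>x\<inverse> x\<close>. Each of them
  acts as a partial identity, so it suffices that it is defined on all of \<open>N\<close>.\<close>

lemma path_relator:
  assumes N: "N \<subseteq> reduced"
    and a: "\<And>p. p \<in> N \<Longrightarrow> \<exists>q. (p, q) \<in> left_mult N a"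
    and x: "\<And>p. p \<in> N \<Longrightarrow> \<exists>q. (q, p) \<in> left_mult N t' O left_mult N a O left_mult N t"
  shows "partial_action.path N (left_mult N) example_relator = Id_on N"
proof -
  interpret partial_action N "left_mult N" using N by (rule partial_action_left_mult)
  have split: "example_relator = ([a] @ [a]) @ word_inv [t', a, t] @ [t', a, t]"
    by (simp add: example_relator_def)
  have "left_mult N a = left_mult N a'" by (auto simp: left_mult_def canonical_def opposite_def)
  then have "path [a] = path (word_inv [a])" by simp
  then have "path ([a] @ [a]) = Id_on (Domain (path [a]))"
    by (metis path_append path_word_inv path_idempotent_left)
  also have "Domain (path [a]) = N"
    using path_subset[of "[a]"] a by (fastforce simp: left_mult_def)
  finally have A: "path ([a] @ [a]) = Id_on N" .
  have "Range (path [t', a, t]) = N"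
  proof -
    have "left_mult N t O Id_on N = left_mult N t"
      by (auto simp: left_mult_def)
    then have "path [t', a, t] = left_mult N t' O left_mult N a O left_mult N t"
      by simp
    then have "\<exists>q. (q, p) \<in> path [t', a, t]" if "p \<in> N" for p
      using x[OF that] by (simp only:)
    moreover have "q \<in> N" if "(p, q) \<in> path [t', a, t]" for p q
      using path_subset[of "[t', a, t]"] that by auto
    ultimately show ?thesis by (intro equalityI subsetI) (auto simp: Range_iff simp del: path.simps)
  qed
  then have X: "path (word_inv [t', a, t] @ [t', a, t]) = Id_on N"
    using path_idempotent_right[of "[t', a, t]"] by (simp only: path_append path_word_inv)
  show ?thesis
    unfolding split path_append[of "[a] @ [a]"] A X by auto
qed

lemma left_mult_reduced:
  assumes "p \<in> reduced" "c \<in> {a, a', t, t'}"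
  shows "\<exists>q. (q, p) \<in> left_mult reduced c"
proof (cases "p \<noteq> [] \<and> hd p = opposite c")
  case True
  then obtain q where q: "p = opposite c # q" by (cases p) auto
  then have "(q, p) \<in> left_mult reduced c"
    using assms by (auto simp: left_mult_def reduced_simps)
  then show ?thesis by blast
next
  case False
  have "opposite (canonical c) = opposite c" by (simp add: opposite_def canonical_def)
  then have "(canonical c # p, p) \<in> left_mult reduced c"
    using False assms by (auto simp: left_mult_def reduced_simps canonical_def)
  then show ?thesis by blast
qed

lemma left_mult_sym: "(p, q) \<in> left_mult N a \<longleftrightarrow> (q, p) \<in> left_mult N a"
  by (auto simp: left_mult_def canonical_def opposite_def)

interpretation K: partial_action reduced "left_mult reduced"
  by (rule partial_action_left_mult) simp

lemma path_K_equal: "u \<approx> v \<Longrightarrow> K.path u = K.path v"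
proof (rule K.path_equal[OF ex.special_inverse_monoid_axioms])
  show "K.path example_relator = Id_on reduced"
  proof (rule path_relator)
    fix p :: "nat word" assume "p \<in> reduced"
    then show "\<exists>q. (p, q) \<in> left_mult reduced a"
      using left_mult_reduced[of p a] left_mult_sym by blast
  next
    fix p :: "nat word" assume p: "p \<in> reduced"
    obtain p1 where p1: "(p1, p) \<in> left_mult reduced t"
      using left_mult_reduced[OF p, of t] by blast
    then obtain p2 where p2: "(p2, p1) \<in> left_mult reduced a"
      using left_mult_reduced[of p1 a] K.rho_subset by blast
    then obtain p3 where "(p3, p2) \<in> left_mult reduced t'"
      using left_mult_reduced[of p2 t'] K.rho_subset by blast
    with p1 p2 show "\<exists>q. (q, p) \<in> left_mult reduced t' O left_mult reduced a O left_mult reduced t"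
      by blast
  qed simp
qed

text \<open>A reduced word represents an element of the submonoid of \<open>K\<close> generated by \<open>a\<close>, \<open>t\<close> and \<open>x\<close> just when it
  lies in this set.\<close>

definition P :: "nat word set" where "P = positive \<inter> reduced"

lemma P_subset: "P \<subseteq> reduced" by (simp add: P_def)

interpretation P: partial_action P "left_mult P"
  by (rule partial_action_left_mult) (rule P_subset)

inductive_cases positive_aE: "a # p \<in> positive"
inductive_cases positive_t'E: "t' # p \<in> positive"

lemma left_mult_P_a:
  assumes "p \<in> P"
  shows "\<exists>q. (q, p) \<in> left_mult P a"
proof (cases "p \<noteq> [] \<and> hd p = a")
  case True
  then obtain q where q: "p = a # q" by (cases p) auto
  then have "(q, p) \<in> left_mult P a"
    using assms by (auto simp: left_mult_def P_def reduced_simps opposite_def canonical_def elim: positive_aE)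
  then show ?thesis by blast
next
  case False
  then have "(a # p, p) \<in> left_mult P a"
    using assms by (auto simp: left_mult_def P_def reduced_simps opposite_def canonical_def intro: positive.a)
  then show ?thesis by blast
qed

text \<open>Closure of the submonoid under left multiplication by \<open>a\<close>, \<open>t\<close> and \<open>x\<close> makes the relator act as the
  identity. A leading \<open>t\<inverse>\<close> that is cancelled in the process is always the start of a factor \<open>x\<close>, so that what
  remains is again a product of these generators.\<close>

lemma path_P_equal: "u \<approx> v \<Longrightarrow> P.path u = P.path v"
proof (rule P.path_equal[OF ex.special_inverse_monoid_axioms])
  show "P.path example_relator = Id_on P"
  proof (rule path_relator)
    show "P \<subseteq> reduced" by (rule P_subset)
    fix p :: "nat word" assume "p \<in> P"
    then show "\<exists>q. (p, q) \<in> left_mult P a"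
      using left_mult_P_a left_mult_sym by blast
  next
    fix p :: "nat word" assume p: "p \<in> P"
    show "\<exists>q. (q, p) \<in> left_mult P t' O left_mult P a O left_mult P t"
    proof (cases "p \<noteq> [] \<and> hd p = t'")
      case True
      then obtain q where q: "p = t' # a # t # q" "q \<in> positive"
        using p by (cases p) (auto simp: P_def elim: positive_t'E)
      then have "(q, t # q) \<in> left_mult P t'" "(t # q, a # t # q) \<in> left_mult P a"
        "(a # t # q, p) \<in> left_mult P t"
        using p by (auto simp: left_mult_def P_def reduced_simps opposite_def canonical_def
            intro: positive.intros)
      then show ?thesis by blast
    next
      case False
      then have "(t' # a # t # p, a # t # p) \<in> left_mult P t'"
        "(a # t # p, t # p) \<in> left_mult P a" "(t # p, p) \<in> left_mult P t"
        using p by (auto simp: left_mult_def P_def reduced_simps opposite_def canonical_def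
            intro: positive.intros)
      then show ?thesis by blast
    qed
  qed
qed

lemma reduced_words: "p \<in> reduced \<Longrightarrow> p \<in> words {0, 1}"
  by (induction p) (auto simp: reduced_simps)

lemma letter_canonical: "[c] \<in> words {0, 1} \<Longrightarrow> [c] \<approx> [canonical c]"
  by (cases c; cases "snd c") (auto simp: canonical_def intro: ex.equal_refl a_inverse)

text \<open>The step that would fail on all of \<open>K\<close> is the cancellation of \<open>t t\<inverse>\<close>. Within \<open>P\<close> it only occurs in
  \<open>t x = a t\<close>.\<close>

lemma left_mult_P_equal:
  assumes "(q, p) \<in> left_mult P c" and c: "[c] \<in> words {0, 1}"
  shows "c # p \<approx> q"
proof -
  have pq: "p \<in> words {0, 1}" "q \<in> words {0, 1}" "p \<in> positive"
    using assms(1) by (simp_all add: left_mult_def P_def reduced_words)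
  have "[c] @ p \<approx> [canonical c] @ p"
    using pq c by (intro ex.equal_append ex.equal_refl letter_canonical)
  also have "[canonical c] @ p \<approx> q"
  proof (cases "q = canonical c # p")
    case True
    then show ?thesis using pq by (auto intro: ex.equal_refl)
  next
    case False
    then have p: "p = opposite c # q" using assms by (auto simp: left_mult_def)
    have cancel: "[canonical c, opposite c] @ q \<approx> [] @ q" if "[canonical c, opposite c] \<approx> []"
      using that pq by (intro ex.equal_append ex.equal_refl)
    consider "canonical c = a" | "canonical c = t'" | "canonical c = t"
      using c by (cases c; cases "snd c") (auto simp: canonical_def)
    then show ?thesis
    proof cases
      case 1
      then have "opposite c = a" by (auto simp: opposite_def canonical_def split: if_splits)
      then show ?thesis using cancel a_square 1 p by simp
    next
      case 2
      then have "opposite c = t" by (auto simp: opposite_def canonical_def split: if_splits)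
      then show ?thesis using cancel t_left_invertible 2 p by simp
    next
      case 3
      then have c: "opposite c = t'" by (auto simp: opposite_def canonical_def split: if_splits)
      then obtain r where r: "q = a # t # r" using pq(3) p by (auto elim: positive_t'E)
      have "[t, t', a, t] @ r \<approx> [a, t] @ r"
        using pq r by (intro ex.equal_append ex.equal_refl t_x) auto
      then show ?thesis using 3 c p r by simp
    qed
  qed
  finally show ?thesis by simp
qed

lemma path_P_word:
  assumes "(q, p) \<in> P.path u" "u \<in> words {0, 1}"
  shows "u @ p \<approx> q"
  using assms
proof (induction u arbitrary: q)
  case Nil
  then show ?case using P_subset by (auto intro!: ex.equal_refl reduced_words)
next
  case (Cons c u)
  then obtain r where r: "(q, r) \<in> left_mult P c" "(r, p) \<in> P.path u" by auto
  have "[c] @ (u @ p) \<approx> [c] @ r"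
    using Cons r by (intro ex.equal_append ex.equal_refl Cons.IH) auto
  also have "\<dots> \<approx> q" using left_mult_P_equal[OF r(1)] Cons by simp
  finally show ?case by simp
qed

text \<open>Each letter either extends the reduced word, or cancels with its first letter; a cancellation of
  \<open>t t\<inverse>\<close> leaves an idempotent behind.\<close>

lemma path_K_word:
  assumes "(q, p) \<in> K.path u" "u \<in> words {0, 1}"
  shows "\<exists>zs. u @ p \<approx> q @ ex.idem zs"
  using assms
proof (induction u arbitrary: q)
  case Nil
  then show ?case by (auto intro!: exI[of _ "[]"] ex.equal_refl reduced_words)
next
  case (Cons c u)
  then obtain r where r: "(q, r) \<in> left_mult reduced c" "(r, p) \<in> K.path u" by auto
  then obtain zs where zs: "u @ p \<approx> r @ ex.idem zs" using Cons by auto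
  have rq: "r \<in> words {0, 1}" "q \<in> words {0, 1}"
    using r(1) by (simp_all add: left_mult_def reduced_words)
  have idem: "ex.idem zs \<in> words {0, 1}" using zs by (simp add: ex.equal_def)
  have c: "[c] \<in> words {0, 1}" using Cons by simp
  have "\<exists>ys. [canonical c] @ r \<approx> q @ ex.idem ys"
  proof (cases "q = canonical c # r")
    case True
    then show ?thesis using rq by (auto intro!: exI[of _ "[]"] ex.equal_refl)
  next
    case False
    then have p: "r = opposite c # q" using r by (auto simp: left_mult_def)
    show ?thesis
    proof (cases "canonical c = a")
      case True
      then have "opposite c = a" by (auto simp: opposite_def canonical_def split: if_splits)
      moreover have "[a, a] @ q \<approx> [] @ q"
        using rq by (intro ex.equal_append ex.equal_refl a_square)
      ultimately show ?thesis using True p by (auto intro!: exI[of _ "[]"])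
    next
      case False
      then have "canonical c = c" "opposite c = (fst c, \<not> snd c)" by (auto simp: canonical_def opposite_def split: if_splits)
      then have "[canonical c] @ r = [c, (fst c, \<not> snd c)] @ q" using p by simp
      then show ?thesis using ex.cancel_below[OF c rq(2)] by metis
    qed
  qed
  then obtain ys where ys: "[canonical c] @ r \<approx> q @ ex.idem ys" by blast
  have "[c] @ (u @ p) \<approx> [canonical c] @ (r @ ex.idem zs)"
    by (rule ex.equal_append[OF letter_canonical[OF c] zs])
  also have "\<dots> = ([canonical c] @ r) @ ex.idem zs" by simp
  also have "\<dots> \<approx> (q @ ex.idem ys) @ ex.idem zs"
    using idem by (intro ex.equal_append ex.equal_refl ys)
  finally have "(c # u) @ p \<approx> q @ ex.idem (ys @ zs)" by simp
  then show ?case by blast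
qed

section \<open>E-unitarity\<close>

lemma path_K_total:
  assumes "u \<in> words {0, 1}"
  shows "Range (K.path u) = reduced"
proof -
  have "\<exists>q. (q, p) \<in> K.path u" if "p \<in> reduced" for p
    using assms
  proof (induction u)
    case (Cons c u)
    then obtain q where q: "(q, p) \<in> K.path u" by auto
    then have "q \<in> reduced" using K.path_subset by auto
    moreover have "c \<in> {a, a', t, t'}" using Cons.prems by (cases c; cases "snd c") auto
    ultimately show ?case using left_mult_reduced q by (metis K.path.simps(2) relcomp.relcompI)
  qed (use that in auto)
  then show ?thesis using K.path_subset by blast
qed

text \<open>The path of \<open>u\<close> is an idempotent permutation of \<open>K\<close>.\<close>

lemma K_idempotent:
  assumes "u @ u \<approx> u"
  shows "K.path u = Id_on reduced"
proof -
  have u: "u \<in> words {0, 1}" using assms by (simp add: ex.equal_def)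
  have "K.path u O K.path u = K.path u"
    using path_K_equal[OF assms] by (simp add: K.path_append)
  moreover have inv: "(K.path u)\<inverse> O K.path u = Id_on reduced"
    using K.path_idempotent_right path_K_total[OF u] by simp
  moreover have "Id_on reduced O K.path u = K.path u"
    using K.path_subset[of u] by auto
  ultimately show ?thesis by (metis O_assoc)
qed

text \<open>If \<open>e\<close> and \<open>e s\<close> are idempotent, then both act trivially on \<open>K\<close>, and so does \<open>s\<close>. Applied to the empty
  word this says that \<open>s\<close> is a product of idempotents.\<close>

lemma E_unitary_example: "E_unitary ex.M"
  unfolding E_unitary_def
proof (intro ballI impI)
  fix e s assume "e \<in> carrier ex.M" "s \<in> carrier ex.M"
  then obtain u v where u: "u \<in> words {0, 1}" "e = ex.cl u" and v: "v \<in> words {0, 1}" "s = ex.cl v"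
    unfolding ex.carrier_M by blast
  assume "e \<otimes>\<^bsub>ex.M\<^esub> e = e"
  then have "u @ u \<approx> u" using u by (simp add: ex.mult_M ex.equal_def)
  then have Ku: "K.path u = Id_on reduced" by (rule K_idempotent)
  assume "(e \<otimes>\<^bsub>ex.M\<^esub> s) \<otimes>\<^bsub>ex.M\<^esub> (e \<otimes>\<^bsub>ex.M\<^esub> s) = e \<otimes>\<^bsub>ex.M\<^esub> s"
  then have "(u @ v) @ (u @ v) \<approx> u @ v" using u v by (simp add: ex.mult_M ex.equal_def)
  then have "K.path (u @ v) = Id_on reduced" by (rule K_idempotent)
  moreover have "Id_on reduced O K.path v = K.path v"
    using K.path_subset[of v] by auto
  ultimately have "K.path v = Id_on reduced" by (simp add: K.path_append Ku)
  then have "([], []) \<in> K.path v" by (auto simp: reduced_simps)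
  then obtain zs where zs: "v \<approx> ex.idem zs" using path_K_word v(1) by fastforce
  have "ex.idem zs @ ex.idem zs \<approx> ex.idem zs"
    using zs by (intro ex.idem_idempotent) (simp add: ex.equal_def)
  then have "v @ v \<approx> v"
    using zs ex.equal_append[OF zs zs] ex.equal_trans ex.equal_sym by blast
  then show "s \<otimes>\<^bsub>ex.M\<^esub> s = s" using v by (simp add: ex.mult_M ex.equal_def)
qed

section \<open>The group of units\<close>

definition t_exponent :: "nat word \<Rightarrow> int" where
  "t_exponent = weight (\<lambda>s. if s = 1 then 1 else 0)"

lemma t_exponent_simps [simp]:
  "t_exponent [] = 0"
  "t_exponent (c # u) = (if fst c = 1 then if snd c then 1 else - 1 else 0) + t_exponent u"
  by (auto simp: t_exponent_def)

lemma t_exponent_path: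
  assumes "(q, p) \<in> P.path u"
  shows "t_exponent q = t_exponent u + t_exponent p"
  using assms
proof (induction u arbitrary: q)
  case (Cons c u)
  then obtain r where r: "(q, r) \<in> left_mult P c" "(r, p) \<in> P.path u" by auto
  then have "t_exponent q = t_exponent [c] + t_exponent r"
    by (auto simp: left_mult_def canonical_def opposite_def)
  then show ?case using Cons.IH[OF r(2)] by simp
qed auto

inductive_set dihedral :: "nat word set" where
  Nil: "[] \<in> dihedral"
| a: "p \<in> dihedral \<Longrightarrow> a # p \<in> dihedral"
| x: "p \<in> dihedral \<Longrightarrow> t' # a # t # p \<in> dihedral"

text \<open>An occurrence of \<open>t\<close> outside a factor \<open>x\<close> contributes \<open>1\<close>, while \<open>a\<close> and \<open>x\<close> contribute nothing.\<close>

lemma positive_exponent: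
  assumes "p \<in> positive"
  shows "t_exponent p \<ge> 0 \<and> (t_exponent p = 0 \<longrightarrow> p \<in> dihedral)"
  using assms by induction (auto intro: dihedral.intros)

lemma Units_iff:
  "g \<in> Units ex.M \<longleftrightarrow> (\<exists>u v. g = ex.cl u \<and> u @ v \<approx> [] \<and> v @ u \<approx> [])"
proof
  assume "g \<in> Units ex.M"
  then obtain h where g: "g \<in> carrier ex.M" and h: "h \<in> carrier ex.M"
    and gh: "g \<otimes>\<^bsub>ex.M\<^esub> h = \<one>\<^bsub>ex.M\<^esub>" "h \<otimes>\<^bsub>ex.M\<^esub> g = \<one>\<^bsub>ex.M\<^esub>"
    by (auto simp: Units_def)
  obtain u v where uv: "u \<in> words {0, 1}" "g = ex.cl u" "v \<in> words {0, 1}" "h = ex.cl v"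
    using g h unfolding ex.carrier_M by blast
  then have "u @ v \<approx> []" "v @ u \<approx> []"
    using gh by (simp_all add: ex.mult_M ex.one_M ex.equal_def)
  then show "\<exists>u v. g = ex.cl u \<and> u @ v \<approx> [] \<and> v @ u \<approx> []"
    using uv(2) by blast
next
  assume "\<exists>u v. g = ex.cl u \<and> u @ v \<approx> [] \<and> v @ u \<approx> []"
  then obtain u v where uv: "g = ex.cl u" "u @ v \<approx> []" "v @ u \<approx> []" by blast
  then have words: "u \<in> words {0, 1}" "v \<in> words {0, 1}" by (simp_all add: ex.equal_def)
  then have "g \<in> carrier ex.M" "ex.cl v \<in> carrier ex.M"
    using uv(1) unfolding ex.carrier_M by blast+
  moreover have "g \<otimes>\<^bsub>ex.M\<^esub> ex.cl v = \<one>\<^bsub>ex.M\<^esub>" "ex.cl v \<otimes>\<^bsub>ex.M\<^esub> g = \<one>\<^bsub>ex.M\<^esub>"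
    using uv words by (simp_all add: ex.mult_M ex.one_M ex.equal_def)
  ultimately show "g \<in> Units ex.M"
    unfolding Units_def by blast
qed

text \<open>If \<open>v u = 1\<close>, then \<open>u\<close> can be applied to the empty word within \<open>P\<close>. For mutually inverse \<open>u\<close> and \<open>v\<close>
  the results have opposite exponents in \<open>t\<close>, both nonnegative.\<close>

lemma unit_dihedral:
  assumes "g \<in> Units ex.M"
  obtains q where "q \<in> dihedral" "g = ex.cl q"
proof -
  obtain u v where uv: "g = ex.cl u" "u @ v \<approx> []" "v @ u \<approx> []"
    using assms Units_iff by auto
  have words: "u \<in> words {0, 1}" using uv(2) by (simp add: ex.equal_def)
  have empty: "[] \<in> P" by (simp add: P_def positive.Nil reduced_simps)
  have left: "\<exists>q. (q, []) \<in> P.path u \<and> ([], q) \<in> P.path v" if "v @ u \<approx> []" for u v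
  proof -
    have "([], []) \<in> P.path (v @ u)" using path_P_equal[OF that] empty by auto
    then show ?thesis by (auto simp: P.path_append)
  qed
  obtain q where q: "(q, []) \<in> P.path u" "([], q) \<in> P.path v" using left[OF uv(3)] by auto
  obtain q' where q': "(q', []) \<in> P.path v" using left[OF uv(2)] by auto
  have pos: "q \<in> positive" "q' \<in> positive"
    using q q' P.path_subset by (auto simp: P_def)
  have "t_exponent v = - t_exponent q" "t_exponent v = t_exponent q'"
    using t_exponent_path[OF q(2)] t_exponent_path[OF q'] by auto
  then have "q \<in> dihedral"
    using positive_exponent[OF pos(1)] positive_exponent[OF pos(2)] by linarith
  moreover have "u \<approx> q" using path_P_word[OF q(1) words] by simp
  ultimately show thesis using that uv(1) by (simp add: ex.equal_def)
qed

lemma involution_unit: "u @ u \<approx> [] \<Longrightarrow> ex.cl u \<in> Units ex.M"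
  using Units_iff by blast

text \<open>Applied to the empty word, a reduced word reproduces itself, so distinct reduced words are distinct
  in \<open>M\<close>.\<close>

lemma reduced_path: "q \<in> reduced \<Longrightarrow> (q, []) \<in> K.path q"
proof (induction q)
  case (Cons c q)
  then have "canonical c = c" "q \<in> reduced" by (auto simp: reduced_simps canonical_def)
  then have "(c # q, q) \<in> left_mult reduced c" using Cons.prems by (simp add: left_mult_def)
  then show ?case using Cons \<open>q \<in> reduced\<close> by auto
qed auto

lemma reduced_equal:
  assumes "p \<approx> q" "p \<in> reduced" "q \<in> reduced"
  shows "p = q"
  using reduced_path[OF assms(2)] reduced_path[OF assms(3)] path_K_equal[OF assms(1)]
    K.injective_path by auto

lemma units_not_commutative:
  "ex.cl [a] \<otimes>\<^bsub>ex.M\<^esub> ex.cl [t', a, t] \<noteq> ex.cl [t', a, t] \<otimes>\<^bsub>ex.M\<^esub> ex.cl [a]"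
proof
  assume "ex.cl [a] \<otimes>\<^bsub>ex.M\<^esub> ex.cl [t', a, t] = ex.cl [t', a, t] \<otimes>\<^bsub>ex.M\<^esub> ex.cl [a]"
  then have "[a, t', a, t] \<approx> [t', a, t, a]" by (simp add: ex.mult_M ex.equal_def)
  then have "[a, t', a, t] = [t', a, t, a]"
    by (rule reduced_equal) (simp_all add: reduced_simps opposite_def canonical_def)
  then show False by simp
qed

text \<open>Units are products of involutions, and the integers have no torsion.\<close>

lemma hom_units_trivial:
  assumes h: "h \<in> hom (units_of ex.M) integer_group" and g: "g \<in> Units ex.M"
  shows "h g = 0"
proof -
  interpret M: monoid ex.M by (rule ex.monoid_M)
  have mult: "h (x \<otimes>\<^bsub>ex.M\<^esub> y) = h x + h y" if "x \<in> Units ex.M" "y \<in> Units ex.M" for x y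
    using hom_mult[OF h] that by (simp add: units_of_def)
  have one: "h (ex.cl []) = 0"
    using mult[of "\<one>\<^bsub>ex.M\<^esub>" "\<one>\<^bsub>ex.M\<^esub>"] by (simp add: ex.one_M[symmetric])
  have invol: "h (ex.cl u) = 0" if "u @ u \<approx> []" for u
  proof -
    have u: "ex.cl u \<in> Units ex.M" using that by (rule involution_unit)
    have "ex.cl u \<otimes>\<^bsub>ex.M\<^esub> ex.cl u = ex.cl []"
      using that by (simp add: ex.equal_def ex.mult_M)
    then show ?thesis using mult[OF u u] one by simp
  qed
  have step: "ex.cl (u @ p) \<in> Units ex.M \<and> h (ex.cl (u @ p)) = 0"
    if "u @ u \<approx> []" "p \<in> words {0, 1}" "ex.cl p \<in> Units ex.M" "h (ex.cl p) = 0" for u p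
  proof -
    have "ex.cl (u @ p) = ex.cl u \<otimes>\<^bsub>ex.M\<^esub> ex.cl p"
      using that by (simp add: ex.equal_def ex.mult_M)
    then show ?thesis using that involution_unit invol mult by simp
  qed
  have "q \<in> words {0, 1} \<and> ex.cl q \<in> Units ex.M \<and> h (ex.cl q) = 0" if "q \<in> dihedral" for q
    using that
  proof induction
    case Nil
    then show ?case using one by (simp add: ex.one_M[symmetric])
  next
    case (a p)
    then show ?case using step[of "[a]" p] a_square by simp
  next
    case (x p)
    then show ?case using step[of "[t', a, t]" p] x_square by simp
  qed
  then show ?thesis using unit_dihedral[OF g] by metis
qed

theorem theorem7p1:
  shows "\<exists>(A :: nat set) w. finite A \<and> w \<in> words A \<and>
    \<not> one_relator_group (units_of (Inv_one_relator A w)) \<and>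
    E_unitary (Inv_one_relator A w)"
proof -
  have not_one_relator: "\<not> one_relator_group (units_of ex.M)"
  proof
    assume one_rel: "one_relator_group (units_of ex.M)"
    have "monoid (units_of ex.M)"
      using monoid.units_group[OF ex.monoid_M] by (rule group.is_monoid)
    then show False
      using one_rel
    proof (cases rule: one_relator_group_cases)
      case commutative
      have "ex.cl [a] \<in> Units ex.M" "ex.cl [t', a, t] \<in> Units ex.M"
        using a_square x_square by (auto intro: involution_unit)
      then show False
        using commutative[of "ex.cl [a]" "ex.cl [t', a, t]"] units_not_commutative
        by (simp add: units_of_def)
    next
      case (hom_integer h g)
      then show False using hom_units_trivial by (simp add: units_of_def)
    qed
  qed
  show ?thesis
  proof (intro exI conjI)
    show "finite {0, 1 :: nat}" by simp
    show "example_relator \<in> words {0, 1}" by (rule ex.relator)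
  qed (rule not_one_relator, rule E_unitary_example)
qed

end
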